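(* Let $E$ be a quasi-Banach ideal space with the Fatou property over $(T,\Sigma,\mu)$ and let $\varphi$ be an Orlicz function. (i) Assume that neither $L_\infty\subset E$ nor $E\subset L_\infty$. Then $\alpha^a_\varphi>0$ if and only if there exist constants $p>0$ and $K\ge1$ such that for any $x\in L^0$ and any $0<a\le1$ we have $\rho^E_\varphi(ax)\le Ka^p\rho^E_\varphi(x)$. (ii) Let $L_\infty\subset E$. Then $\alpha^\infty_\varphi>0$ if and only if there is a constant $p>0$ such that for all $v_0>0$ there exists $K=K(v_0)\ge1$ such that for any $x\in L^0$ satisfying $|x(t)|\ge v_0$ for $\mu$-a.e. $t\in T$ and any $0<a\le1$ we have $\rho^E_\varphi(ax)\le Ka^p\rho^E_\varphi(x)$. (iii) Let $E\subset L_\infty$. Then $\alpha^0_\varphi>0$ if and only if there is a constant $p>0$ such that for all $A>0$ there exists $K=K(A)\ge1$ such that for any $x\in L^0$ satisfying $\rho^E_\varphi(x)\le A$ and any $0<a\le1$ we have $\rho^E_\varphi(ax)\le Ka^p\rho^E_\varphi(x)$.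
   Context: $(T,\Sigma,\mu)$ is a complete $\sigma$-finite measure space with $\mu(T)>0$; $L^0$ is the space of ($\mu$-a.e. classes of) real $\Sigma$-measurable functions on $T$, with the a.e. order; $L_\infty=L_\infty(T,\Sigma,\mu)$. A quasi-norm is a functional satisfying the axioms of a norm with the triangle inequality replaced by $\|x+y\|\le C(\|x\|+\|y\|)$ for some constant $C\ge1$. A quasi-Banach ideal space is a linear subspace $E\subset L^0$ with a complete quasi-norm $\|\cdot\|_E$ such that (i) $x\in L^0$, $y\in E$, $|x|\le|y|$ a.e. imply $x\in E$, $\|x\|_E\le\|y\|_E$; (ii) some $x\in E$ is strictly positive on $T$. $E$ has the Fatou property if $0\le x_n\uparrow|x|$ a.e., $x_n\in E$, $x\in L^0$, $\sup_n\|x_n\|_E<\infty$ imply $x\in E$ and $\|x_n\|_E\to\|x\|_E$. An Orlicz function is a non-decreasing $\varphi:[0,\infty)\to[0,\infty]$ with $\varphi(0)=0$, right continuous at $0$, continuous on $(0,b_\varphi)$ and left continuous at $b_\varphi$, where $b_\varphi=\sup\{u\ge0:\varphi(u)<\infty\}$, and with $\lim_{u\to\infty}\varphi(u)=\infty$. Lower Matuszewska–Orlicz indices: $\alpha^a_\varphi$ is the supremum of $p\in\mathbb R$ for which there is $K\ge1$ with $\varphi(au)\le Ka^p\varphi(u)$ for all $u\ge0$, $0<a\le1$; $\alpha^\infty_\varphi$ is the supremum of $p\in\mathbb R$ for which there are $K\ge1$, $u_0>0$ with $\varphi(u_0)<\infty$ and this inequality for all $u\ge u_0$, $0<a\le1$;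 $\alpha^0_\varphi$ is the supremum of $p\in\mathbb R$ for which there are $K\ge1$, $u_0>0$ with this inequality for all $0\le u\le u_0$, $0<a\le1$. $\rho^E_\varphi(x)=\|\varphi(|x|)\|_E$ if $\varphi(|x|)\in E$, and $\rho^E_\varphi(x)=\infty$ otherwise. *)

theory Defs
  imports "HOL-Analysis.Analysis"
begin

text \<open>
  Elements of \<open>L\<^sup>0\<close>, i.e. classes of measurable functions modulo equality almost everywhere, are
  represented by measurable functions \<open>'a \<Rightarrow> real\<close>. A space \<open>E \<subseteq> L\<^sup>0\<close> is a set of such
  functions; the ideal property makes \<open>E\<close> and its quasi-norm invariant under equality almost
  everywhere, so that they descend to classes.
\<close>

abbreviation L0_space :: "'a measure \<Rightarrow> ('a \<Rightarrow> real) set"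
  where "L0_space M \<equiv> borel_measurable M"

definition Linf_space :: "'a measure \<Rightarrow> ('a \<Rightarrow> real) set"
  where "Linf_space M = {x \<in> L0_space M. \<exists>C. AE t in M. \<bar>x t\<bar> \<le> C}"

locale quasi_banach_ideal_space =
  fixes M :: "'a measure" and E :: "('a \<Rightarrow> real) set" and nrm :: "('a \<Rightarrow> real) \<Rightarrow> real"
  assumes subset_L0: "E \<subseteq> L0_space M"
    and zero_mem: "(\<lambda>t. 0) \<in> E"
    and add_mem: "\<lbrakk>x \<in> E; y \<in> E\<rbrakk> \<Longrightarrow> (\<lambda>t. x t + y t) \<in> E"
    and scale_mem: "x \<in> E \<Longrightarrow> (\<lambda>t. c * x t) \<in> E"
    and nrm_nonneg: "x \<in> E \<Longrightarrow> 0 \<le> nrm x"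
    and nrm_eq_0_iff: "x \<in> E \<Longrightarrow> nrm x = 0 \<longleftrightarrow> (AE t in M. x t = 0)"
    and nrm_scale: "x \<in> E \<Longrightarrow> nrm (\<lambda>t. c * x t) = \<bar>c\<bar> * nrm x"
    and nrm_quasi_triangle:
      "\<exists>C\<ge>1. \<forall>x\<in>E. \<forall>y\<in>E. nrm (\<lambda>t. x t + y t) \<le> C * (nrm x + nrm y)"
    and complete:
      "\<lbrakk>\<And>n. X n \<in> E;
        \<forall>e>0. \<exists>N. \<forall>m\<ge>N. \<forall>n\<ge>N. nrm (\<lambda>t. X m t - X n t) < e\<rbrakk>
       \<Longrightarrow> \<exists>x\<in>E. (\<lambda>n::nat. nrm (\<lambda>t. X n t - x t)) \<longlonglongrightarrow> 0"
    and ideal_mem: "\<lbrakk>x \<in> L0_space M; y \<in> E; AE t in M. \<bar>x t\<bar> \<le> \<bar>y t\<bar>\<rbrakk> \<Longrightarrow> x \<in> E"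
    and ideal_nrm: "\<lbrakk>x \<in> L0_space M; y \<in> E; AE t in M. \<bar>x t\<bar> \<le> \<bar>y t\<bar>\<rbrakk> \<Longrightarrow> nrm x \<le> nrm y"
    and strictly_positive: "\<exists>x\<in>E. \<forall>t\<in>space M. 0 < x t"

definition fatou_property ::
  "'a measure \<Rightarrow> ('a \<Rightarrow> real) set \<Rightarrow> (('a \<Rightarrow> real) \<Rightarrow> real) \<Rightarrow> bool"
  where "fatou_property M E nrm \<longleftrightarrow>
    (\<forall>(X :: nat \<Rightarrow> 'a \<Rightarrow> real) x.
       (\<forall>n. X n \<in> E) \<longrightarrow> x \<in> L0_space M \<longrightarrow>
       (AE t in M. (\<forall>n. 0 \<le> X n t) \<and> incseq (\<lambda>n. X n t) \<and> (\<lambda>n. X n t) \<longlonglongrightarrow> \<bar>x t\<bar>) \<longrightarrow>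
       bdd_above (range (\<lambda>n. nrm (X n))) \<longrightarrow>
       x \<in> E \<and> (\<lambda>n. nrm (X n)) \<longlonglongrightarrow> nrm x)"

text \<open>
  A function \<open>\<phi> : [0,\<infinity>) \<rightarrow> [0,\<infinity>]\<close> is given as \<open>\<phi> :: real \<Rightarrow> ennreal\<close>; its values at negative
  arguments play no role.
\<close>

definition finiteness_bound :: "(real \<Rightarrow> ennreal) \<Rightarrow> ereal"
  where "finiteness_bound \<phi> = (SUP u\<in>{u. 0 \<le> u \<and> \<phi> u < \<infinity>}. ereal u)"

text \<open>Left continuity at \<open>b\<^sub>\<phi>\<close> is a condition only if \<open>b\<^sub>\<phi> < \<infinity>\<close>.\<close>

definition orlicz_function :: "(real \<Rightarrow> ennreal) \<Rightarrow> bool"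
  where "orlicz_function \<phi> \<longleftrightarrow>
    mono_on {0..} \<phi> \<and>
    \<phi> 0 = 0 \<and>
    continuous (at_right 0) \<phi> \<and>
    continuous_on {u. 0 < u \<and> ereal u < finiteness_bound \<phi>} \<phi> \<and>
    (\<forall>b. ereal b = finiteness_bound \<phi> \<longrightarrow> continuous (at_left b) \<phi>) \<and>
    (\<phi> \<longlongrightarrow> \<infinity>) at_top"

definition lower_index_all :: "(real \<Rightarrow> ennreal) \<Rightarrow> ereal"
  where "lower_index_all \<phi> = Sup {ereal p | p. \<exists>K\<ge>1. \<forall>u\<ge>0. \<forall>a. 0 < a \<and> a \<le> 1 \<longrightarrow>
    \<phi> (a * u) \<le> ennreal (K * a powr p) * \<phi> u}"

definition lower_index_inf :: "(real \<Rightarrow> ennreal) \<Rightarrow> ereal"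
  where "lower_index_inf \<phi> = Sup {ereal p | p. \<exists>K\<ge>1. \<exists>u0>0. \<phi> u0 < \<infinity> \<and>
    (\<forall>u\<ge>u0. \<forall>a. 0 < a \<and> a \<le> 1 \<longrightarrow> \<phi> (a * u) \<le> ennreal (K * a powr p) * \<phi> u)}"

definition lower_index_zero :: "(real \<Rightarrow> ennreal) \<Rightarrow> ereal"
  where "lower_index_zero \<phi> = Sup {ereal p | p. \<exists>K\<ge>1. \<exists>u0>0.
    \<forall>u. 0 \<le> u \<and> u \<le> u0 \<longrightarrow>
      (\<forall>a. 0 < a \<and> a \<le> 1 \<longrightarrow> \<phi> (a * u) \<le> ennreal (K * a powr p) * \<phi> u)}"

text \<open>
  \<open>\<phi>(|x|) \<in> E \<subseteq> L\<^sup>0\<close> entails that \<open>\<phi>(|x|)\<close> is finite almost everywhere; this is made explicit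
  because \<open>enn2real\<close> maps \<open>\<infinity>\<close> to \<open>0\<close>.
\<close>

definition orlicz_modular ::
  "'a measure \<Rightarrow> ('a \<Rightarrow> real) set \<Rightarrow> (('a \<Rightarrow> real) \<Rightarrow> real) \<Rightarrow> (real \<Rightarrow> ennreal) \<Rightarrow>
   ('a \<Rightarrow> real) \<Rightarrow> ennreal"
  where "orlicz_modular M E nrm \<phi> x =
    (if (AE t in M. \<phi> \<bar>x t\<bar> < \<infinity>) \<and> (\<lambda>t. enn2real (\<phi> \<bar>x t\<bar>)) \<in> E
     then ennreal (nrm (\<lambda>t. enn2real (\<phi> \<bar>x t\<bar>))) else \<infinity>)"

end

theory Submission
  imports Defs
begin

text \<open>
  In all three parts the modular inequality is equivalent to the pointwise inequality
  \<open>\<phi>(au) \<le> K a\<^sup>p \<phi>(u)\<close>, \<open>0 < a \<le> 1\<close>, required only for those \<open>u\<close> that the admissible functions \<open>x\<close>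
  can take as values: all \<open>u \<ge> 0\<close> in the first part, \<open>u \<ge> v\<^sub>0\<close> in the second, \<open>0 \<le> u \<le> B\<close> in the third,
  with \<open>B\<close> depending on the bound \<open>A\<close> for the modular.

  From pointwise to modular, the ideal property carries the inequality over to quasi-norms
  (\<open>modular_scaling\<close>). Conversely, for \<open>\<chi>\<^sub>S \<in> E\<close> of positive quasi-norm the modular of \<open>u \<chi>\<^sub>S\<close> is
  \<open>\<phi>(u) \<parallel>\<chi>\<^sub>S\<parallel>\<close>, so testing the modular inequality on such functions and dividing by \<open>\<parallel>\<chi>\<^sub>S\<parallel>\<close> returns
  the pointwise one (\<open>scaling_bound_of_modular\<close>). A suitable \<open>S\<close> exists because \<open>E\<close> contains a strictly
  positive function; if \<open>L\<^sub>\<infinity> \<subseteq> E\<close>, then \<open>S\<close> can be the whole space, as is needed when \<open>|x| \<ge> v\<^sub>0\<close>.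

  What remains is to compare ranges of \<open>u\<close>. A positive index gives the inequality only above, or
  only below, some threshold \<open>u\<^sub>0\<close>, whereas it is needed above every \<open>v\<^sub>0 > 0\<close>, or below
  every \<open>B\<close>. The same exponent \<open>p\<close> survives with a larger constant (\<open>scaling_bound_below\<close>,
  \<open>scaling_bound_above\<close>), since between the two thresholds the monotonicity of \<open>\<phi>\<close>
  and the inequality at \<open>u\<^sub>0\<close> take over.

  The third part also needs that a bound on the modular of \<open>x\<close> bounds \<open>x\<close> itself
  (\<open>modular_bounded_imp_bounded\<close>). This rests on the automatic continuity of the inclusion
  \<open>E \<subseteq> L\<^sub>\<infinity>\<close> (\<open>bounded_embedding_Linf\<close>): otherwise there are functions of very small quasi-norm
  exceeding any given constant, and by completeness a series of such functions has a sum in \<open>E\<close>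
  that is not essentially bounded.
\<close>

section \<open>The pointwise growth condition\<close>

definition scaling_bound :: "(real \<Rightarrow> ennreal) \<Rightarrow> real \<Rightarrow> real \<Rightarrow> real \<Rightarrow> bool"
  where "scaling_bound \<phi> p K u \<longleftrightarrow>
    (\<forall>a. 0 < a \<and> a \<le> 1 \<longrightarrow> \<phi> (a * u) \<le> ennreal (K * a powr p) * \<phi> u)"

lemma scaling_bound_mono:
  assumes "scaling_bound \<phi> p K u" "K \<le> K'"
  shows "scaling_bound \<phi> p K' u"
  unfolding scaling_bound_def
proof (intro allI impI)
  fix a :: real assume a: "0 < a \<and> a \<le> 1"
  have "\<phi> (a * u) \<le> ennreal (K * a powr p) * \<phi> u"
    using assms(1) a by (simp add: scaling_bound_def)
  also have "\<dots> \<le> ennreal (K' * a powr p) * \<phi> u"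
    by (intro mult_right_mono ennreal_leI) (use assms(2) in auto)
  finally show "\<phi> (a * u) \<le> ennreal (K' * a powr p) * \<phi> u" .
qed

lemma Sup_ereal_pos_iff: "0 < Sup {ereal p | p. Q p} \<longleftrightarrow> (\<exists>p>0. Q p)"
  unfolding less_Sup_iff by force

lemma lower_index_all_pos_iff:
  "0 < lower_index_all \<phi> \<longleftrightarrow> (\<exists>p>0. \<exists>K\<ge>1. \<forall>u\<ge>0. scaling_bound \<phi> p K u)"
  unfolding lower_index_all_def scaling_bound_def Sup_ereal_pos_iff by (rule refl)

lemma lower_index_inf_pos_iff:
  "0 < lower_index_inf \<phi> \<longleftrightarrow>
     (\<exists>p>0. \<exists>K\<ge>1. \<exists>u0>0. \<phi> u0 < \<infinity> \<and> (\<forall>u\<ge>u0. scaling_bound \<phi> p K u))"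
  unfolding lower_index_inf_def scaling_bound_def Sup_ereal_pos_iff by (rule refl)

lemma lower_index_zero_pos_iff:
  "0 < lower_index_zero \<phi> \<longleftrightarrow>
     (\<exists>p>0. \<exists>K\<ge>1. \<exists>u0>0. \<forall>u. 0 \<le> u \<and> u \<le> u0 \<longrightarrow> scaling_bound \<phi> p K u)"
  unfolding lower_index_zero_def scaling_bound_def Sup_ereal_pos_iff by (rule refl)

section \<open>Orlicz functions\<close>

lemma orlicz_mono:
  assumes "orlicz_function \<phi>" "0 \<le> u" "u \<le> v"
  shows "\<phi> u \<le> \<phi> v"
  using assms by (auto simp: orlicz_function_def intro: mono_onD)

lemma orlicz_zero: "orlicz_function \<phi> \<Longrightarrow> \<phi> 0 = 0"
  by (simp add: orlicz_function_def)

lemma orlicz_small_values: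
  assumes "orlicz_function \<phi>" "0 < \<epsilon>"
  obtains u where "0 < u" "\<phi> u < \<epsilon>"
proof -
  have "(\<phi> \<longlongrightarrow> 0) (at_right 0)"
    using assms(1) by (auto simp: orlicz_function_def continuous_within)
  then have "\<forall>\<^sub>F u in at_right 0. \<phi> u < \<epsilon>"
    using assms(2) by (rule order_tendstoD)
  then obtain b where "b > 0" "\<And>u. 0 < u \<Longrightarrow> u < b \<Longrightarrow> \<phi> u < \<epsilon>"
    by (auto simp: eventually_at_right_field)
  then show thesis using that[of "b / 2"] by auto
qed

lemma orlicz_large_values:
  assumes "orlicz_function \<phi>" "c < \<infinity>"
  obtains B where "0 < B" "c < \<phi> B"
proof -
  have "(\<phi> \<longlongrightarrow> \<infinity>) at_top"
    using assms(1) by (auto simp: orlicz_function_def)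
  then have "\<forall>\<^sub>F u in at_top. c < \<phi> u"
    using assms(2) by (rule order_tendstoD)
  then have "\<forall>\<^sub>F u in at_top. c < \<phi> u \<and> 0 < u"
    using eventually_gt_at_top by (rule eventually_conj)
  then show thesis
    using that eventually_happens'[OF trivial_limit_at_top_linorder] by blast
qed

text \<open>
  By monotonicity, the sets where \<open>\<phi>\<close> exceeds a given value are intervals, hence Borel. The detour
  over \<open>max 0\<close> extends \<open>\<phi>\<close> monotonically to the negative half line.
\<close>

lemma orlicz_measurable:
  assumes "orlicz_function \<phi>" and [measurable]: "x \<in> borel_measurable M"
  shows "(\<lambda>t. \<phi> \<bar>x t\<bar>) \<in> borel_measurable M"
proof -
  have "(\<lambda>u. \<phi> (max 0 u)) \<in> borel_measurable borel"
  proof (rule borel_measurableI_greater)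
    fix y
    have "\<phi> (max 0 u) \<le> \<phi> (max 0 v)" if "u \<le> v" for u v
      using that by (intro orlicz_mono[OF assms(1)]) auto
    then have "is_interval {u. y < \<phi> (max 0 u)}"
      unfolding is_interval_1 by (simp, meson less_le_trans)
    then show "{u \<in> space borel. y < \<phi> (max 0 u)} \<in> sets borel"
      using real_interval_borel_measurable by simp
  qed
  then have "(\<lambda>t. \<phi> (max 0 \<bar>x t\<bar>)) \<in> borel_measurable M"
    by measurable
  then show ?thesis by simp
qed

section \<open>Moving the threshold\<close>

text \<open>
  For \<open>v\<^sub>0 \<le> u < u\<^sub>0\<close> one compares with \<open>\<phi>(u\<^sub>0)\<close>, at the cost of the factor \<open>\<phi>(u\<^sub>0)/\<phi>(v\<^sub>0)\<close>. If
  \<open>\<phi>(v\<^sub>0) = 0\<close> this factor is not available, but then \<open>\<phi>(au)\<close> vanishes unless \<open>au > v\<^sub>0\<close>, and this keeps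
  \<open>a\<close> above \<open>v\<^sub>0/u\<^sub>0\<close>, hence \<open>a\<^sup>p\<close> away from zero.
\<close>

lemma scaling_bound_below:
  assumes \<phi>: "orlicz_function \<phi>" and "1 \<le> K" "0 < v0" "0 < u0" "0 \<le> p"
    and bound: "\<And>u. u0 \<le> u \<Longrightarrow> scaling_bound \<phi> p K u" and fin: "\<phi> u0 < \<infinity>"
  shows "\<exists>K\<ge>1. \<forall>u\<ge>v0. scaling_bound \<phi> p K u"
proof (cases "\<phi> v0 = 0")
  case True
  define L where "L = max K ((u0 / v0) powr p)"
  have "scaling_bound \<phi> p L u" if u: "v0 \<le> u" for u
  proof (cases "u0 \<le> u")
    case True
    then show ?thesis using bound scaling_bound_mono L_def by fastforce
  next
    case False
    have "\<phi> (a * u) \<le> ennreal (L * a powr p) * \<phi> u" if a: "0 < a" "a \<le> 1" for a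
    proof (cases "a * u \<le> v0")
      case True
      then have "\<phi> (a * u) \<le> \<phi> v0"
        using a u \<open>0 < v0\<close> by (intro orlicz_mono[OF \<phi>]) auto
      then show ?thesis using \<open>\<phi> v0 = 0\<close> by simp
    next
      case nle: False
      have "a * u \<le> a * u0" using a False by simp
      with nle have "v0 \<le> a * u0" by simp
      then have "1 \<le> (u0 / v0) * a" using \<open>0 < v0\<close> by (simp add: field_simps)
      then have "1 powr p \<le> ((u0 / v0) * a) powr p"
        by (intro powr_mono2) (use \<open>0 \<le> p\<close> in auto)
      also have "\<dots> = (u0 / v0) powr p * a powr p"
        using a \<open>0 < v0\<close> \<open>0 < u0\<close> by (intro powr_mult)
      also have "\<dots> \<le> L * a powr p"
        unfolding L_def by (intro mult_right_mono) auto
      finally have "1 \<le> ennreal (L * a powr p)"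
        by (metis ennreal_leI ennreal_1 powr_one_eq_one)
      have "\<phi> (a * u) \<le> 1 * \<phi> u"
        using orlicz_mono[OF \<phi>, of "a * u" u] a u \<open>0 < v0\<close>
        by (simp add: mult_le_cancel_right1)
      also have "\<dots> \<le> ennreal (L * a powr p) * \<phi> u"
        by (intro mult_right_mono) (use \<open>1 \<le> ennreal (L * a powr p)\<close> in auto)
      finally show ?thesis .
    qed
    then show ?thesis by (auto simp: scaling_bound_def)
  qed
  moreover have "1 \<le> L" using \<open>1 \<le> K\<close> by (simp add: L_def)
  ultimately show ?thesis by blast
next
  case False
  define r where "r = enn2real (\<phi> u0 / \<phi> v0)"
  have "\<phi> u0 / \<phi> v0 < \<infinity>"
    using False fin by (simp add: ennreal_divide_eq_top_iff less_top[symmetric])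
  then have r: "ennreal r = \<phi> u0 / \<phi> v0" by (simp add: r_def)
  have r0: "0 \<le> r" by (simp add: r_def)
  define L where "L = K * max 1 r"
  have L: "K \<le> L" "K * r \<le> L" using \<open>1 \<le> K\<close> by (auto simp: L_def)
  have "scaling_bound \<phi> p L u" if u: "v0 \<le> u" for u
  proof (cases "u0 \<le> u")
    case True
    then show ?thesis using bound scaling_bound_mono L by blast
  next
    case le: False
    have vu: "\<phi> v0 \<le> \<phi> u" using u \<open>0 < v0\<close> by (intro orlicz_mono[OF \<phi>]) auto
    have "\<phi> u \<le> \<phi> u0" using u le \<open>0 < v0\<close> by (intro orlicz_mono[OF \<phi>]) auto
    with vu fin have "\<phi> v0 < \<infinity>" by auto
    then have "\<phi> u0 = ennreal r * \<phi> v0"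
      using False unfolding r by (simp add: ennreal_divide_times)
    also have "\<dots> \<le> ennreal r * \<phi> u" using vu by (intro mult_left_mono) auto
    finally have u0u: "\<phi> u0 \<le> ennreal r * \<phi> u" .
    have "\<phi> (a * u) \<le> ennreal (L * a powr p) * \<phi> u" if a: "0 < a" "a \<le> 1" for a
    proof -
      have "\<phi> (a * u) \<le> \<phi> (a * u0)"
        using a u le \<open>0 < v0\<close> by (intro orlicz_mono[OF \<phi>]) auto
      also have "\<dots> \<le> ennreal (K * a powr p) * \<phi> u0"
        using bound[of u0] a by (simp add: scaling_bound_def)
      also have "\<dots> \<le> ennreal (K * a powr p) * (ennreal r * \<phi> u)"
        using u0u by (intro mult_left_mono) auto
      also have "\<dots> = ennreal (K * r * a powr p) * \<phi> u"
        using r0 \<open>1 \<le> K\<close> by (simp add: ennreal_mult' ennreal_mult'' mult_ac)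
      also have "\<dots> \<le> ennreal (L * a powr p) * \<phi> u"
        by (intro mult_right_mono ennreal_leI) (use L in auto)
      finally show ?thesis .
    qed
    then show ?thesis by (auto simp: scaling_bound_def)
  qed
  moreover have "1 \<le> L" using L \<open>1 \<le> K\<close> by simp
  ultimately show ?thesis by blast
qed

text \<open>
  With \<open>b \<ge> B, u\<^sub>0\<close> and \<open>u\<^sub>0 < u \<le> b\<close>, the factor \<open>(b/u\<^sub>0)\<^sup>p\<close> is enough. If \<open>au > u\<^sub>0\<close>, then \<open>a > u\<^sub>0/b\<close>
  and \<open>a\<^sup>p (b/u\<^sub>0)\<^sup>p \<ge> 1\<close>, so monotonicity applies. If \<open>au \<le> u\<^sub>0\<close>, then \<open>au\<close> is a multiple
  \<open>c u\<^sub>0\<close> with \<open>c \<le> 1\<close> and \<open>c \<le> a b/u\<^sub>0\<close>, so the inequality known at \<open>u\<^sub>0\<close> applies.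
\<close>

lemma scaling_bound_above:
  assumes \<phi>: "orlicz_function \<phi>" and "1 \<le> K" "0 < u0" "0 \<le> p"
    and bound: "\<And>u. 0 \<le> u \<Longrightarrow> u \<le> u0 \<Longrightarrow> scaling_bound \<phi> p K u"
  shows "\<exists>K\<ge>1. \<forall>u. 0 \<le> u \<and> u \<le> B \<longrightarrow> scaling_bound \<phi> p K u"
proof -
  define b where "b = max B u0"
  have b: "B \<le> b" "u0 \<le> b" "0 < b" using \<open>0 < u0\<close> by (auto simp: b_def)
  define L where "L = K * (b / u0) powr p"
  have q: "1 \<le> (b / u0) powr p"
    using b \<open>0 < u0\<close> \<open>0 \<le> p\<close> by (intro ge_one_powr_ge_zero) auto
  have "K * 1 \<le> K * (b / u0) powr p" "1 * (b / u0) powr p \<le> K * (b / u0) powr p"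
    by (intro mult_left_mono mult_right_mono; use q \<open>1 \<le> K\<close> in auto)+
  then have L: "K \<le> L" "(b / u0) powr p \<le> L" by (auto simp: L_def)
  have "scaling_bound \<phi> p L u" if u: "0 \<le> u" "u \<le> B" for u
  proof (cases "u \<le> u0")
    case True
    then show ?thesis using bound scaling_bound_mono L u by blast
  next
    case gt: False
    have "\<phi> (a * u) \<le> ennreal (L * a powr p) * \<phi> u" if a: "0 < a" "a \<le> 1" for a
    proof (cases "a * u \<le> u0")
      case True
      define c where "c = a * u / u0"
      have c: "0 < c" "c \<le> 1" "c * u0 = a * u"
        using a gt True \<open>0 < u0\<close> by (auto simp: c_def)
      have "c \<le> a * (b / u0)"
        using u b a \<open>0 < u0\<close> by (auto simp: c_def field_simps)
      then have "c powr p \<le> (a * (b / u0)) powr p"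
        using c \<open>0 \<le> p\<close> by (intro powr_mono2) auto
      also have "\<dots> = a powr p * (b / u0) powr p"
        using a b \<open>0 < u0\<close> by (intro powr_mult)
      finally have cp: "K * c powr p \<le> L * a powr p"
        using \<open>1 \<le> K\<close> by (simp add: L_def mult_ac)
      have "\<phi> (c * u0) \<le> ennreal (K * c powr p) * \<phi> u0"
        using bound[of u0] c(1,2) \<open>0 < u0\<close> unfolding scaling_bound_def by simp
      also have "\<dots> \<le> ennreal (L * a powr p) * \<phi> u"
        using mult_mono[OF ennreal_leI[OF cp] orlicz_mono[OF \<phi>, of u0 u]] gt \<open>0 < u0\<close> by simp
      finally show ?thesis using c by simp
    next
      case False
      have "u0 \<le> a * b"
        using False u b a mult_left_mono[of u b a] by linarith
      then have "1 \<le> (b / u0) * a" using \<open>0 < u0\<close> by (simp add: field_simps)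
      then have "1 powr p \<le> ((b / u0) * a) powr p"
        by (intro powr_mono2) (use \<open>0 \<le> p\<close> in auto)
      also have "\<dots> = (b / u0) powr p * a powr p"
        using a b \<open>0 < u0\<close> by (intro powr_mult)
      also have "\<dots> \<le> L * a powr p"
        using L by (intro mult_right_mono) auto
      finally have one: "1 \<le> ennreal (L * a powr p)"
        by (metis ennreal_leI ennreal_1 powr_one_eq_one)
      have "\<phi> (a * u) \<le> 1 * \<phi> u"
        using orlicz_mono[OF \<phi>, of "a * u" u] a u by (simp add: mult_left_le_one_le)
      also have "\<dots> \<le> ennreal (L * a powr p) * \<phi> u"
        by (intro mult_right_mono) (use one in auto)
      finally show ?thesis .
    qed
    then show ?thesis by (auto simp: scaling_bound_def)
  qed
  moreover have "1 \<le> L" using L \<open>1 \<le> K\<close> by simp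
  ultimately show ?thesis by blast
qed

section \<open>Pointwise and modular inequalities\<close>

context quasi_banach_ideal_space
begin

text \<open>
  If the modular of \<open>x\<close> is finite, the ideal property applies to \<open>\<phi>(|y|) \<le> c \<phi>(|x|)\<close>. If it is infinite,
  the right-hand side is \<open>c \<cdot> \<infinity> = \<infinity>\<close>; this is where \<open>c > 0\<close> matters.
\<close>

lemma modular_le_mult:
  assumes \<phi>: "orlicz_function \<phi>"
    and [measurable]: "x \<in> L0_space M" "y \<in> L0_space M" and "0 < c"
    and le: "AE t in M. \<phi> \<bar>y t\<bar> \<le> ennreal c * \<phi> \<bar>x t\<bar>"
  shows "orlicz_modular M E nrm \<phi> y \<le> ennreal c * orlicz_modular M E nrm \<phi> x"
proof (cases "(AE t in M. \<phi> \<bar>x t\<bar> < \<infinity>) \<and> (\<lambda>t. enn2real (\<phi> \<bar>x t\<bar>)) \<in> E")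
  case False
  then have "orlicz_modular M E nrm \<phi> x = \<infinity>" by (simp only: orlicz_modular_def if_False)
  then show ?thesis using \<open>0 < c\<close> by (simp add: ennreal_mult_top)
next
  case True
  let ?X = "\<lambda>t. enn2real (\<phi> \<bar>x t\<bar>)" and ?Y = "\<lambda>t. enn2real (\<phi> \<bar>y t\<bar>)"
  have fin: "AE t in M. \<phi> \<bar>y t\<bar> < \<infinity>"
  proof -
    have "AE t in M. \<phi> \<bar>x t\<bar> < \<infinity>" using True by blast
    with le show ?thesis
      by eventually_elim (auto elim!: le_less_trans simp: ennreal_mult_less_top)
  qed
  have XY: "AE t in M. \<bar>?Y t\<bar> \<le> \<bar>c * ?X t\<bar>"
  proof -
    have "AE t in M. \<phi> \<bar>x t\<bar> < \<infinity>" using True by blast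
    with le show ?thesis
    proof eventually_elim
      case (elim t)
      have "?Y t \<le> enn2real (ennreal c * \<phi> \<bar>x t\<bar>)"
        using elim by (intro enn2real_mono) (auto simp: ennreal_mult_less_top)
      then show ?case using \<open>0 < c\<close> by (simp add: enn2real_mult)
    qed
  qed
  have Ym: "?Y \<in> L0_space M" using orlicz_measurable[OF \<phi>] by measurable
  have cX: "(\<lambda>t. c * ?X t) \<in> E" using True by (intro scale_mem) auto
  have "?Y \<in> E" using Ym cX XY by (rule ideal_mem)
  then have "orlicz_modular M E nrm \<phi> y = ennreal (nrm ?Y)"
    using fin by (simp add: orlicz_modular_def)
  also have "\<dots> \<le> ennreal (c * nrm ?X)"
    using ideal_nrm[OF Ym cX XY] nrm_scale[of ?X c] True \<open>0 < c\<close> by (intro ennreal_leI) auto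
  also have "\<dots> = ennreal c * orlicz_modular M E nrm \<phi> x"
    using True \<open>0 < c\<close> by (simp add: orlicz_modular_def ennreal_mult')
  finally show ?thesis .
qed

lemma modular_scaling:
  assumes "orlicz_function \<phi>" "x \<in> L0_space M" "0 < K" "0 < a" "a \<le> 1"
    and "AE t in M. scaling_bound \<phi> p K \<bar>x t\<bar>"
  shows "orlicz_modular M E nrm \<phi> (\<lambda>t. a * x t)
    \<le> ennreal (K * a powr p) * orlicz_modular M E nrm \<phi> x"
proof (rule modular_le_mult)
  show "AE t in M. \<phi> \<bar>a * x t\<bar> \<le> ennreal (K * a powr p) * \<phi> \<bar>x t\<bar>"
    using assms(6) by eventually_elim (use assms(4,5) in \<open>auto simp: scaling_bound_def abs_mult\<close>)
qed (use assms in auto)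

lemma modular_indicator:
  assumes \<phi>: "orlicz_function \<phi>" and S: "indicator S \<in> E" and "0 \<le> u" "\<phi> u < \<infinity>"
  shows "orlicz_modular M E nrm \<phi> (\<lambda>t. u * indicator S t) = \<phi> u * ennreal (nrm (indicator S))"
proof -
  have eq: "\<phi> \<bar>u * indicator S t\<bar> = ennreal (enn2real (\<phi> u) * indicator S t)" for t
    using assms by (auto simp: indicator_def orlicz_zero)
  have fin: "AE t in M. \<phi> \<bar>u * indicator S t\<bar> < \<infinity>"
    unfolding eq by simp
  have eq': "(\<lambda>t. enn2real (\<phi> \<bar>u * indicator S t\<bar>)) = (\<lambda>t. enn2real (\<phi> u) * indicator S t)"
    unfolding eq by (simp add: fun_eq_iff)
  show ?thesis
    using scale_mem[OF S] nrm_scale[OF S, of "enn2real (\<phi> u)"] assms(4) nrm_nonneg[OF S] fin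
    unfolding orlicz_modular_def eq' by (simp add: ennreal_mult)
qed

text \<open>
  The modular inequality for the single test function \<open>u \<chi>\<^sub>S\<close> gives the pointwise inequality at \<open>u\<close>,
  after cancelling the factor \<open>\<parallel>\<chi>\<^sub>S\<parallel>\<close>. It may be assumed that \<open>\<phi>(u)\<close> is finite, since
  otherwise the right-hand side of the pointwise inequality is infinite.
\<close>

lemma scaling_bound_of_modular:
  assumes \<phi>: "orlicz_function \<phi>" and S: "indicator S \<in> E" "0 < nrm (indicator S)"
    and "0 \<le> u" "0 < K"
    and le: "\<And>a. \<phi> u < \<infinity> \<Longrightarrow> 0 < a \<Longrightarrow> a \<le> 1 \<Longrightarrow>
      orlicz_modular M E nrm \<phi> (\<lambda>t. a * (u * indicator S t))
        \<le> ennreal (K * a powr p) * orlicz_modular M E nrm \<phi> (\<lambda>t. u * indicator S t)"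
  shows "scaling_bound \<phi> p K u"
  unfolding scaling_bound_def
proof (intro allI impI)
  fix a :: real assume a: "0 < a \<and> a \<le> 1"
  show "\<phi> (a * u) \<le> ennreal (K * a powr p) * \<phi> u"
  proof (cases "\<phi> u < \<infinity>")
    case False
    then show ?thesis using a \<open>0 < K\<close> by (simp add: ennreal_mult_top less_top[symmetric])
  next
    case True
    have "\<phi> (a * u) \<le> \<phi> u"
      using a \<open>0 \<le> u\<close> by (intro orlicz_mono[OF \<phi>]) (auto simp: mult_left_le_one_le)
    then have fin: "\<phi> (a * u) < \<infinity>" using True by simp
    have "\<phi> (a * u) * ennreal (nrm (indicator S))
        = orlicz_modular M E nrm \<phi> (\<lambda>t. (a * u) * indicator S t)"
      using a \<open>0 \<le> u\<close> fin by (subst modular_indicator[OF \<phi> S(1)]) auto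
    also have "\<dots> = orlicz_modular M E nrm \<phi> (\<lambda>t. a * (u * indicator S t))"
      by (simp add: mult.assoc)
    also have "\<dots> \<le> ennreal (K * a powr p) * orlicz_modular M E nrm \<phi> (\<lambda>t. u * indicator S t)"
      using le[OF True] a by simp
    also have "\<dots> = (ennreal (K * a powr p) * \<phi> u) * ennreal (nrm (indicator S))"
      using \<open>0 \<le> u\<close> True by (subst modular_indicator[OF \<phi> S(1)]) (auto simp: mult.assoc)
    finally show ?thesis
      using S(2) by (simp add: ennreal_mult_le_mult_iff mult.commute[of _ "ennreal (nrm _)"])
  qed
qed

lemma nrm_indicator_pos:
  assumes "S \<in> sets M" "emeasure M S \<noteq> 0" "indicator S \<in> E"
  shows "0 < nrm (indicator S)"
proof -
  have "\<not> (AE t in M. indicator S t = (0::real))"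
    using assms(2) AE_iff_measurable[OF assms(1), of "\<lambda>t. indicator S t = (0::real)"]
      sets.sets_into_space[OF assms(1)] by (auto simp: indicator_def)
  then have "nrm (indicator S) \<noteq> 0"
    using nrm_eq_0_iff[OF assms(3)] by simp
  then show ?thesis using nrm_nonneg[OF assms(3)] by simp
qed

text \<open>
  A strictly positive \<open>w \<in> E\<close> dominates \<open>1/n\<close> times the indicator of \<open>{w > 1/n}\<close>. These sets exhaust
  the space, so one of them is not null.
\<close>

lemma ex_indicator_nonnull:
  assumes "emeasure M (space M) \<noteq> 0"
  obtains S where "S \<in> sets M" "indicator S \<in> E" "0 < nrm (indicator S)"
proof -
  obtain w where w: "w \<in> E" "\<And>t. t \<in> space M \<Longrightarrow> 0 < w t"
    using strictly_positive by blast
  have [measurable]: "w \<in> borel_measurable M" using w subset_L0 by blast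
  define S where "S n = {t \<in> space M. 1 < real n * w t}" for n
  have [measurable]: "S n \<in> sets M" for n unfolding S_def by measurable
  have "(\<Union>n. S n) = space M"
  proof -
    have "\<exists>n. 1 < real n * w t" if "t \<in> space M" for t
      using w(2)[OF that] by (rule ex_less_of_nat_mult)
    then show ?thesis by (auto simp: S_def)
  qed
  then obtain n where n: "emeasure M (S n) \<noteq> 0"
    using assms emeasure_UN_eq_0[of M S] by fastforce
  have "indicator (S n) \<in> E"
  proof (rule ideal_mem)
    show "(\<lambda>t. real n * w t) \<in> E" using w by (intro scale_mem)
    show "AE t in M. \<bar>indicator (S n) t :: real\<bar> \<le> \<bar>real n * w t\<bar>"
      by (intro AE_I2) (auto simp: S_def indicator_def)
  qed measurable
  moreover from this have "0 < nrm (indicator (S n))"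
    using n by (intro nrm_indicator_pos) measurable
  ultimately show thesis by (intro that[of "S n"]) measurable
qed

section \<open>Continuity of the inclusion into the bounded functions\<close>

text \<open>
  A substitute for countable subadditivity. Splitting off one summand at a time, each use of the
  quasi-triangle inequality costs a factor \<open>C\<close>; quasi-norms decaying like \<open>(2C)\<^sup>-\<^sup>n\<close> compensate
  for this exactly, as \<open>C ((2C)\<^sup>-\<^sup>m + 2C (2C)\<^sup>-\<^sup>m\<^sup>-\<^sup>1) = 2C (2C)\<^sup>-\<^sup>m\<close>, so the bound reproduces itself.
\<close>

lemma subseries_nrm_bound:
  assumes C: "1 \<le> C" "\<And>x y. x \<in> E \<Longrightarrow> y \<in> E \<Longrightarrow> nrm (\<lambda>t. x t + y t) \<le> C * (nrm x + nrm y)"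
    and Y: "\<And>n. Y n \<in> E" "\<And>n. nrm (Y n) \<le> 1 / (2 * C) ^ n"
  shows "(\<lambda>t. \<Sum>k<j. Y (m + k) t) \<in> E \<and>
    nrm (\<lambda>t. \<Sum>k<j. Y (m + k) t) \<le> 2 * C / (2 * C) ^ m"
proof (induction j arbitrary: m)
  case 0
  have "nrm (\<lambda>t. 0) = 0" using nrm_eq_0_iff[OF zero_mem] by simp
  then show ?case using zero_mem C by simp
next
  case (Suc j)
  let ?R = "\<lambda>t. \<Sum>k<j. Y (Suc m + k) t"
  have eq: "(\<lambda>t. \<Sum>k<Suc j. Y (m + k) t) = (\<lambda>t. Y m t + ?R t)"
    by (subst sum.lessThan_Suc_shift) simp
  have "nrm (\<lambda>t. Y m t + ?R t) \<le> C * (nrm (Y m) + nrm ?R)"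
    using Suc.IH[of "Suc m"] by (intro C Y) auto
  also have "\<dots> \<le> C * (1 / (2 * C) ^ m + 2 * C / (2 * C) ^ Suc m)"
    using Suc.IH[of "Suc m"] Y(2)[of m] C(1) by (intro mult_left_mono add_mono) auto
  also have "\<dots> = 2 * C / (2 * C) ^ m"
    using C(1) by (simp add: field_simps)
  finally show ?case
    unfolding eq using Suc.IH[of "Suc m"] Y(1) by (auto intro: add_mem)
qed

text \<open>
  For \<open>m \<ge> n\<close> the positive part of \<open>X\<^sub>n - s\<close> is dominated by \<open>|X\<^sub>m - s|\<close>, whose quasi-norm becomes
  arbitrarily small.
\<close>

lemma monotone_limit_upper_bound:
  assumes X: "\<And>n. X n \<in> E" and mono: "\<And>m n t. m \<le> n \<Longrightarrow> X m t \<le> X n t"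
    and s: "s \<in> E" and lim: "(\<lambda>n. nrm (\<lambda>t. X n t - s t)) \<longlonglongrightarrow> 0"
  shows "AE t in M. X n t \<le> s t"
proof -
  have diff: "(\<lambda>t. X m t - s t) \<in> E" for m
    using add_mem[OF X[of m] scale_mem[OF s, of "-1"]] by simp
  have [measurable]: "X n \<in> borel_measurable M" "s \<in> borel_measurable M"
    using X s subset_L0 by auto
  let ?P = "\<lambda>t. max 0 (X n t - s t)"
  have Pm: "?P \<in> L0_space M" by measurable
  have dom: "AE t in M. \<bar>?P t\<bar> \<le> \<bar>X m t - s t\<bar>" if "n \<le> m" for m
    using mono[OF that] by (intro AE_I2) (smt (verit))
  have P: "?P \<in> E" using ideal_mem[OF Pm diff dom] by blast
  have "nrm ?P \<le> 0"
    using lim by (rule LIMSEQ_le_const) (use ideal_nrm[OF Pm diff dom] in blast)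
  then have "AE t in M. ?P t = 0"
    using nrm_eq_0_iff[OF P] nrm_nonneg[OF P] by simp
  then show ?thesis by eventually_elim auto
qed

text \<open>
  A gliding hump argument. If no constant works, there are \<open>Y\<^sub>n \<ge> 0\<close> in \<open>E\<close> of quasi-norm at most
  \<open>(2C)\<^sup>-\<^sup>n\<close> that are not bounded by \<open>n\<close> almost everywhere. Their partial sums are increasing and
  Cauchy, so their limit \<open>s \<in> E\<close> lies above each \<open>Y\<^sub>n\<close>. But \<open>s\<close> is essentially bounded.
\<close>

lemma bounded_embedding_Linf:
  assumes "E \<subseteq> Linf_space M"
  shows "\<exists>D>0. \<forall>y\<in>E. AE t in M. \<bar>y t\<bar> \<le> D * nrm y"
proof (rule ccontr)
  assume nothesis: "\<not> ?thesis"
  have bad: "\<exists>y\<in>E. \<not> (AE t in M. \<bar>y t\<bar> \<le> D * nrm y)" if D: "0 < D" for D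
    using nothesis D by blast
  obtain C where C: "1 \<le> C"
    "\<And>x y. x \<in> E \<Longrightarrow> y \<in> E \<Longrightarrow> nrm (\<lambda>t. x t + y t) \<le> C * (nrm x + nrm y)"
    using nrm_quasi_triangle by blast
  have "\<forall>n. \<exists>z. z \<in> E \<and> (\<forall>t. 0 \<le> z t) \<and> nrm z \<le> 1 / (2 * C) ^ n \<and> \<not> (AE t in M. z t \<le> real n)"
  proof
    fix n
    \<comment> \<open>A function violating the bound with this \<open>D\<close>, scaled to quasi-norm \<open>(2C)\<^sup>-\<^sup>n\<close>, exceeds \<open>n\<close> on a
        set that is not null; \<open>Suc n\<close> instead of \<open>n\<close> keeps \<open>D\<close> positive for \<open>n = 0\<close>.\<close>
    define D where "D = real (Suc n) * (2 * C) ^ n"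
    have D: "0 < D" using C by (simp add: D_def)
    obtain y where y: "y \<in> E" "\<not> (AE t in M. \<bar>y t\<bar> \<le> D * nrm y)"
      using bad[OF D] by blast
    have [measurable]: "y \<in> borel_measurable M" using y subset_L0 by blast
    have pos: "0 < nrm y"
    proof (rule ccontr)
      assume "\<not> 0 < nrm y"
      then have 0: "nrm y = 0" using nrm_nonneg[OF y(1)] by simp
      then have "AE t in M. y t = 0" using nrm_eq_0_iff[OF y(1)] by simp
      then show False using y(2) by (simp add: 0)
    qed
    define c where "c = 1 / (nrm y * (2 * C) ^ n)"
    have c: "0 < c" using pos C by (simp add: c_def)
    let ?z = "\<lambda>t. \<bar>c * y t\<bar>"
    have cy: "(\<lambda>t. c * y t) \<in> E" using y by (intro scale_mem)
    have zm: "?z \<in> L0_space M" by measurable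
    have z: "?z \<in> E" using zm cy by (rule ideal_mem) simp
    have "nrm ?z \<le> nrm (\<lambda>t. c * y t)" using zm cy by (rule ideal_nrm) simp
    also have "\<dots> = 1 / (2 * C) ^ n"
      using nrm_scale[OF y(1), of c] c pos by (simp add: c_def)
    finally have nz: "nrm ?z \<le> 1 / (2 * C) ^ n" .
    have "\<not> (AE t in M. ?z t \<le> real n)"
    proof
      assume "AE t in M. ?z t \<le> real n"
      then have "AE t in M. \<bar>y t\<bar> \<le> D * nrm y"
      proof eventually_elim
        case (elim t)
        have "c * \<bar>y t\<bar> \<le> real (Suc n)" using elim c by (simp add: abs_mult)
        also have "\<dots> = c * (D * nrm y)" using pos C by (simp add: c_def D_def)
        finally show ?case using c by simp
      qed
      with y(2) show False by simp
    qed
    with z nz show "\<exists>z. z \<in> E \<and> (\<forall>t. 0 \<le> z t) \<and> nrm z \<le> 1 / (2 * C) ^ n \<and>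
        \<not> (AE t in M. z t \<le> real n)"
      by (intro exI[of _ ?z]) simp
  qed
  from choice[OF this] obtain Y
    where Y: "\<And>n. Y n \<in> E" "\<And>n t. 0 \<le> Y n t" "\<And>n. nrm (Y n) \<le> 1 / (2 * C) ^ n"
    "\<And>n. \<not> (AE t in M. Y n t \<le> real n)"
    by blast
  define X where "X n t = (\<Sum>k<n. Y k t)" for n t
  note bound = subseries_nrm_bound[where Y = Y, OF C Y(1,3)]
  have X: "X n \<in> E" for n
  proof -
    have "(\<lambda>t. \<Sum>k<n. Y (0 + k) t) = X n" unfolding X_def by (simp only: add_0)
    with bound[where j = n and m = 0] show ?thesis by metis
  qed
  have mono: "X m t \<le> X n t" if "m \<le> n" for m n t
    unfolding X_def using that Y(2) by (intro sum_mono2) auto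
  have tail: "nrm (\<lambda>t. X n t - X m t) \<le> 2 * C / (2 * C) ^ m" if "m \<le> n" for m n
  proof -
    have "X n t - X m t = (\<Sum>k<n - m. Y (m + k) t)" for t
    proof -
      have "X n t = X m t + (\<Sum>k\<in>{m..<n}. Y k t)"
        unfolding X_def using that
        by (metis (no_types) atLeast0LessThan sum.atLeastLessThan_concat zero_le)
      moreover have "(\<Sum>k\<in>{m..<n}. Y k t) = (\<Sum>k<n - m. Y (m + k) t)"
        using that sum.shift_bounds_nat_ivl[of "\<lambda>k. Y k t" 0 m "n - m"]
        by (simp add: atLeast0LessThan add.commute)
      ultimately show ?thesis by simp
    qed
    then have "(\<lambda>t. X n t - X m t) = (\<lambda>t. \<Sum>k<n - m. Y (m + k) t)" by (rule ext)
    then show ?thesis using bound[where j = "n - m" and m = m] by metis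
  qed
  have sym: "nrm (\<lambda>t. X m t - X n t) = nrm (\<lambda>t. X n t - X m t)" for m n
  proof -
    have "(\<lambda>t. X n t - X m t) \<in> E"
      using add_mem[OF X[of n] scale_mem[OF X[of m], of "-1"]] by simp
    from nrm_scale[OF this, of "-1"] show ?thesis by simp
  qed
  have "\<exists>s\<in>E. (\<lambda>n. nrm (\<lambda>t. X n t - s t)) \<longlonglongrightarrow> 0"
  proof (rule complete[OF X], intro allI impI)
    fix e :: real assume "0 < e"
    have "(\<lambda>m. 2 * C * (1 / (2 * C)) ^ m) \<longlonglongrightarrow> 2 * C * 0"
      using C(1) by (intro tendsto_intros LIMSEQ_power_zero) auto
    then have "\<forall>\<^sub>F m in sequentially. 2 * C * (1 / (2 * C)) ^ m < e"
      using \<open>0 < e\<close> by (intro order_tendstoD) auto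
    then obtain N where N: "\<And>m. N \<le> m \<Longrightarrow> 2 * C / (2 * C) ^ m < e"
      by (auto simp: eventually_sequentially power_one_over)
    have "nrm (\<lambda>t. X m t - X n t) < e" if "N \<le> m" "N \<le> n" for m n
    proof (cases "m \<le> n")
      case True
      then show ?thesis using tail[OF True] N[OF that(1)] sym[of m n] by linarith
    next
      case False
      then show ?thesis using tail[of n m] N[OF that(2)] by linarith
    qed
    then show "\<exists>N. \<forall>m\<ge>N. \<forall>n\<ge>N. nrm (\<lambda>t. X m t - X n t) < e" by blast
  qed
  then obtain s where s: "s \<in> E" "(\<lambda>n. nrm (\<lambda>t. X n t - s t)) \<longlonglongrightarrow> 0" by blast
  obtain c where c: "AE t in M. \<bar>s t\<bar> \<le> c"
    using s(1) assms by (auto simp: Linf_space_def)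
  obtain n where n: "c \<le> real n" using real_arch_simple by blast
  have "AE t in M. X (Suc n) t \<le> s t"
    using X mono s by (rule monotone_limit_upper_bound)
  with c have "AE t in M. Y n t \<le> real n"
  proof eventually_elim
    case (elim t)
    have "Y n t \<le> X (Suc n) t" using Y(2) by (auto simp: X_def intro: sum_nonneg)
    then show ?case using elim n by linarith
  qed
  with Y(4) show False by blast
qed

text \<open>
  By the continuous inclusion, \<open>\<phi>(|x|) \<le> D A\<close> almost everywhere, and \<open>\<phi>\<close> exceeds \<open>D A\<close> from some
  point on.
\<close>

lemma modular_bounded_imp_bounded:
  assumes \<phi>: "orlicz_function \<phi>" and "E \<subseteq> Linf_space M"
  obtains B where "\<And>x. orlicz_modular M E nrm \<phi> x \<le> ennreal A \<Longrightarrow> AE t in M. \<bar>x t\<bar> \<le> B"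
proof -
  obtain D where D: "0 < D" "\<And>y. y \<in> E \<Longrightarrow> AE t in M. \<bar>y t\<bar> \<le> D * nrm y"
    using bounded_embedding_Linf[OF assms(2)] by blast
  obtain B where B: "0 < B" "ennreal (D * max 0 A) < \<phi> B"
    using orlicz_large_values[OF \<phi>, of "ennreal (D * max 0 A)"] by auto
  have "AE t in M. \<bar>x t\<bar> \<le> B" if x: "orlicz_modular M E nrm \<phi> x \<le> ennreal A" for x
  proof -
    let ?X = "\<lambda>t. enn2real (\<phi> \<bar>x t\<bar>)"
    have fin: "AE t in M. \<phi> \<bar>x t\<bar> < \<infinity>" and X: "?X \<in> E" and "ennreal (nrm ?X) \<le> ennreal A"
      using x by (auto simp: orlicz_modular_def top_unique split: if_splits)
    then have "nrm ?X \<le> max 0 A"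
      by (metis ennreal_le_iff ennreal_neg max.cobounded1 max.coboundedI2 max_def nle_le nrm_nonneg ennreal_le_iff2)
    then have le: "D * nrm ?X \<le> D * max 0 A" using D(1) by (intro mult_left_mono) auto
    from fin D(2)[OF X] show ?thesis
    proof eventually_elim
      case (elim t)
      have "\<phi> \<bar>x t\<bar> = ennreal (?X t)" using elim by simp
      also have "\<dots> \<le> ennreal (D * max 0 A)" using elim le by (intro ennreal_leI) simp
      also have "\<dots> < \<phi> B" by (rule B)
      finally have "\<phi> \<bar>x t\<bar> < \<phi> B" .
      then show ?case using orlicz_mono[OF \<phi>, of B "\<bar>x t\<bar>"] B(1) by force
    qed
  qed
  with that show thesis by blast
qed

end

section \<open>Indices and modular inequalities\<close>

theorem theorem4p10:
  fixes M :: "'a measure"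
    and E :: "('a \<Rightarrow> real) set"
    and nrm :: "('a \<Rightarrow> real) \<Rightarrow> real"
    and \<phi> :: "real \<Rightarrow> ennreal"
  assumes "complete_measure M"
    and "sigma_finite_measure M"
    and "0 < emeasure M (space M)"
    and "quasi_banach_ideal_space M E nrm"
    and "fatou_property M E nrm"
    and "orlicz_function \<phi>"
  shows
    "(\<not> Linf_space M \<subseteq> E \<and> \<not> E \<subseteq> Linf_space M \<longrightarrow>
       (0 < lower_index_all \<phi> \<longleftrightarrow>
         (\<exists>p>0. \<exists>K\<ge>1. \<forall>x\<in>L0_space M. \<forall>a. 0 < a \<and> a \<le> 1 \<longrightarrow>
            orlicz_modular M E nrm \<phi> (\<lambda>t. a * x t)
              \<le> ennreal (K * a powr p) * orlicz_modular M E nrm \<phi> x)))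
     \<and>
     (Linf_space M \<subseteq> E \<longrightarrow>
       (0 < lower_index_inf \<phi> \<longleftrightarrow>
         (\<exists>p>0. \<forall>v0>0. \<exists>K\<ge>1. \<forall>x\<in>L0_space M. (AE t in M. v0 \<le> \<bar>x t\<bar>) \<longrightarrow>
            (\<forall>a. 0 < a \<and> a \<le> 1 \<longrightarrow>
              orlicz_modular M E nrm \<phi> (\<lambda>t. a * x t)
                \<le> ennreal (K * a powr p) * orlicz_modular M E nrm \<phi> x))))
     \<and>
     (E \<subseteq> Linf_space M \<longrightarrow>
       (0 < lower_index_zero \<phi> \<longleftrightarrow>
         (\<exists>p>0. \<forall>A>0. \<exists>K\<ge>1. \<forall>x\<in>L0_space M. orlicz_modular M E nrm \<phi> x \<le> ennreal A \<longrightarrow>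
            (\<forall>a. 0 < a \<and> a \<le> 1 \<longrightarrow>
              orlicz_modular M E nrm \<phi> (\<lambda>t. a * x t)
                \<le> ennreal (K * a powr p) * orlicz_modular M E nrm \<phi> x))))"
proof -
  interpret quasi_banach_ideal_space M E nrm by fact
  note \<phi> = \<open>orlicz_function \<phi>\<close>
  have T: "emeasure M (space M) \<noteq> 0" using assms(3) by simp
  obtain S where S: "S \<in> sets M" "indicator S \<in> E" "0 < nrm (indicator S)"
    using ex_indicator_nonnull[OF T] .
  have uS: "(\<lambda>t. u * indicator S t) \<in> L0_space M" for u :: real
    using S(1) by measurable
  have i: "0 < lower_index_all \<phi> \<longleftrightarrow>
         (\<exists>p>0. \<exists>K\<ge>1. \<forall>x\<in>L0_space M. \<forall>a. 0 < a \<and> a \<le> 1 \<longrightarrow>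
            orlicz_modular M E nrm \<phi> (\<lambda>t. a * x t)
              \<le> ennreal (K * a powr p) * orlicz_modular M E nrm \<phi> x)"
    (is "_ \<longleftrightarrow> (\<exists>p>0. \<exists>K\<ge>1. ?P p K)")
  proof -
    have "(\<forall>u\<ge>0. scaling_bound \<phi> p K u) \<longleftrightarrow> ?P p K" if "1 \<le> K" for p K
    proof
      assume "\<forall>u\<ge>0. scaling_bound \<phi> p K u"
      then show "?P p K" using that by (auto intro!: modular_scaling[OF \<phi>])
    next
      assume P: "?P p K"
      show "\<forall>u\<ge>0. scaling_bound \<phi> p K u"
      proof (intro allI impI)
        fix u :: real assume "0 \<le> u"
        show "scaling_bound \<phi> p K u"
          using \<phi> S(2,3) \<open>0 \<le> u\<close>
          by (rule scaling_bound_of_modular) (use P uS that in auto)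
      qed
    qed
    then show ?thesis unfolding lower_index_all_pos_iff by blast
  qed
  have ii: "0 < lower_index_inf \<phi> \<longleftrightarrow>
         (\<exists>p>0. \<forall>v0>0. \<exists>K\<ge>1. \<forall>x\<in>L0_space M. (AE t in M. v0 \<le> \<bar>x t\<bar>) \<longrightarrow>
            (\<forall>a. 0 < a \<and> a \<le> 1 \<longrightarrow>
              orlicz_modular M E nrm \<phi> (\<lambda>t. a * x t)
                \<le> ennreal (K * a powr p) * orlicz_modular M E nrm \<phi> x))" (is "_ \<longleftrightarrow> ?R")
    if Linf: "Linf_space M \<subseteq> E"
  proof
    assume "0 < lower_index_inf \<phi>"
    then obtain p K u0 where p: "0 < p" and K: "1 \<le> K" and u0: "0 < u0" "\<phi> u0 < \<infinity>"
      and bound: "\<And>u. u0 \<le> u \<Longrightarrow> scaling_bound \<phi> p K u"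
      unfolding lower_index_inf_pos_iff by auto
    have "\<exists>K\<ge>1. \<forall>x\<in>L0_space M. (AE t in M. v0 \<le> \<bar>x t\<bar>) \<longrightarrow>
            (\<forall>a. 0 < a \<and> a \<le> 1 \<longrightarrow>
              orlicz_modular M E nrm \<phi> (\<lambda>t. a * x t)
                \<le> ennreal (K * a powr p) * orlicz_modular M E nrm \<phi> x)" if v0: "0 < v0" for v0
    proof -
      obtain L where L: "1 \<le> L" "\<And>u. v0 \<le> u \<Longrightarrow> scaling_bound \<phi> p L u"
        using scaling_bound_below[OF \<phi> K v0 u0(1) less_imp_le[OF p] bound u0(2)] by blast
      have "AE t in M. scaling_bound \<phi> p L \<bar>x t\<bar>" if "AE t in M. v0 \<le> \<bar>x t\<bar>" for x
        using that by eventually_elim (rule L)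
      then show ?thesis
        using L(1) by (intro exI[of _ L] conjI ballI impI allI modular_scaling[OF \<phi>]) auto
    qed
    with p show ?R by blast
  next
    assume ?R
    then obtain p where p: "0 < p" and ex: "\<And>v0. 0 < v0 \<Longrightarrow>
        \<exists>K\<ge>1. \<forall>x\<in>L0_space M. (AE t in M. v0 \<le> \<bar>x t\<bar>) \<longrightarrow>
            (\<forall>a. 0 < a \<and> a \<le> 1 \<longrightarrow>
              orlicz_modular M E nrm \<phi> (\<lambda>t. a * x t)
                \<le> ennreal (K * a powr p) * orlicz_modular M E nrm \<phi> x)" by blast
    \<comment> \<open>The definition of the index requires a threshold at which \<open>\<phi>\<close> is finite.\<close>
    obtain v0 where v0: "0 < v0" "\<phi> v0 < \<infinity>"
      using orlicz_small_values[OF \<phi>, of \<infinity>] by auto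
    obtain K where K: "1 \<le> K" and le: "\<And>x a. x \<in> L0_space M \<Longrightarrow> AE t in M. v0 \<le> \<bar>x t\<bar> \<Longrightarrow>
        0 < a \<Longrightarrow> a \<le> 1 \<Longrightarrow> orlicz_modular M E nrm \<phi> (\<lambda>t. a * x t)
                \<le> ennreal (K * a powr p) * orlicz_modular M E nrm \<phi> x"
      using ex[OF v0(1)] by blast
    have mem: "indicator (space M) \<in> E"
      using Linf by (force simp: Linf_space_def indicator_def)
    have "scaling_bound \<phi> p K u" if "v0 \<le> u" for u
      using \<phi> mem nrm_indicator_pos[OF sets.top T mem]
      by (rule scaling_bound_of_modular) (use that v0 K in \<open>auto intro!: le\<close>)
    then show "0 < lower_index_inf \<phi>"
      unfolding lower_index_inf_pos_iff using p K v0 by blast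
  qed
  have iii: "0 < lower_index_zero \<phi> \<longleftrightarrow>
         (\<exists>p>0. \<forall>A>0. \<exists>K\<ge>1. \<forall>x\<in>L0_space M. orlicz_modular M E nrm \<phi> x \<le> ennreal A \<longrightarrow>
            (\<forall>a. 0 < a \<and> a \<le> 1 \<longrightarrow>
              orlicz_modular M E nrm \<phi> (\<lambda>t. a * x t)
                \<le> ennreal (K * a powr p) * orlicz_modular M E nrm \<phi> x))" (is "_ \<longleftrightarrow> ?R")
    if Linf: "E \<subseteq> Linf_space M"
  proof
    assume "0 < lower_index_zero \<phi>"
    then obtain p K u0 where p: "0 < p" and K: "1 \<le> K" and u0: "0 < u0"
      and bound: "\<And>u. 0 \<le> u \<Longrightarrow> u \<le> u0 \<Longrightarrow> scaling_bound \<phi> p K u"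
      unfolding lower_index_zero_pos_iff by auto
    have "\<exists>K\<ge>1. \<forall>x\<in>L0_space M. orlicz_modular M E nrm \<phi> x \<le> ennreal A \<longrightarrow>
            (\<forall>a. 0 < a \<and> a \<le> 1 \<longrightarrow>
              orlicz_modular M E nrm \<phi> (\<lambda>t. a * x t)
                \<le> ennreal (K * a powr p) * orlicz_modular M E nrm \<phi> x)" for A
    proof -
      obtain B where B: "\<And>x. orlicz_modular M E nrm \<phi> x \<le> ennreal A \<Longrightarrow> AE t in M. \<bar>x t\<bar> \<le> B"
        using modular_bounded_imp_bounded[OF \<phi> Linf] by blast
      obtain L where L: "1 \<le> L" "\<And>u. 0 \<le> u \<Longrightarrow> u \<le> B \<Longrightarrow> scaling_bound \<phi> p L u"
        using scaling_bound_above[OF \<phi> K u0 less_imp_le[OF p] bound] by blast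
      have "AE t in M. scaling_bound \<phi> p L \<bar>x t\<bar>"
        if "orlicz_modular M E nrm \<phi> x \<le> ennreal A" for x
        using B[OF that] by eventually_elim (auto intro: L)
      then show ?thesis
        using L(1) by (intro exI[of _ L] conjI ballI impI allI modular_scaling[OF \<phi>]) auto
    qed
    with p show ?R by blast
  next
    assume ?R
    then obtain p K where p: "0 < p" and K: "1 \<le> K" and le: "\<And>x a. x \<in> L0_space M \<Longrightarrow>
        orlicz_modular M E nrm \<phi> x \<le> ennreal 1 \<Longrightarrow>
        0 < a \<Longrightarrow> a \<le> 1 \<Longrightarrow> orlicz_modular M E nrm \<phi> (\<lambda>t. a * x t)
                \<le> ennreal (K * a powr p) * orlicz_modular M E nrm \<phi> x"
      using zero_less_one[where 'a = real] by (elim exE conjE allE[of _ "1::real"]) auto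
    \<comment> \<open>Up to this \<open>u\<^sub>0\<close> the test functions \<open>u \<chi>\<^sub>S\<close> have modular at most \<open>1\<close>, so the case \<open>A = 1\<close> applies.\<close>
    obtain u0 where u0: "0 < u0" "\<phi> u0 < ennreal (1 / nrm (indicator S))"
      using orlicz_small_values[OF \<phi>, of "ennreal (1 / nrm (indicator S))"] S(3) by auto
    have "scaling_bound \<phi> p K u" if u: "0 \<le> u" "u \<le> u0" for u
    proof -
      have "\<phi> u \<le> \<phi> u0" using u by (rule orlicz_mono[OF \<phi>])
      then have "\<phi> u \<le> ennreal (1 / nrm (indicator S))" using u0 by simp
      then have "\<phi> u * ennreal (nrm (indicator S))
          \<le> ennreal (1 / nrm (indicator S)) * ennreal (nrm (indicator S))"
        by (intro mult_right_mono) auto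
      also have "\<dots> = ennreal 1" using S(3) by (simp flip: ennreal_mult)
      finally have small: "\<phi> u * ennreal (nrm (indicator S)) \<le> ennreal 1" .
      show ?thesis
      proof (rule scaling_bound_of_modular[OF \<phi> S(2,3) u(1)])
        fix a :: real assume a: "\<phi> u < \<infinity>" "0 < a" "a \<le> 1"
        have "orlicz_modular M E nrm \<phi> (\<lambda>t. u * indicator S t) \<le> ennreal 1"
          using small modular_indicator[OF \<phi> S(2) u(1) a(1)] by simp
        then show "orlicz_modular M E nrm \<phi> (\<lambda>t. a * (u * indicator S t))
            \<le> ennreal (K * a powr p) * orlicz_modular M E nrm \<phi> (\<lambda>t. u * indicator S t)"
          using le[OF uS] a by blast
      qed (use K in simp)
    qed
    then show "0 < lower_index_zero \<phi>"
      unfolding lower_index_zero_pos_iff using p K u0 by blast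
  qed
  show ?thesis using i ii iii by blast
qed

end
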